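(* Consider $\min_{x\in\mathbb{R}^d}h(x)$, $h=f+g$, where $h$ is $\mu$-strongly convex with $\mu>0$ (i.e. $h(x)\ge h(y)+\langle\nabla h(y),x-y\rangle+\frac{\mu}{2}\|x-y\|^2$ for all $x,y\in\mathbb{R}^d$), $g$ is convex, and $\|\nabla^2 f_1(x)-\nabla^2 f(x)\|\le\delta_f$, $\|\nabla^2 g_1(x)-\nabla^2 g(x)\|\le\delta_g$ for all $x\in\mathbb{R}^d$, with $\mu<\delta_f<\delta_g$. Apply the algorithm C-AccExtragradient to this problem, and apply AccExtragradient for $A_\theta^k$ to its subproblem at each iteration $k$ until the accuracy $$\left\|\nabla A_\theta^k(\overline{x}_{k+1})\right\|^2\le\frac{\delta_f^2}{3}\left\|\underline{x}_k-\arg\min_{x\in\mathbb{R}^d}A_\theta^k(x)\right\|^2$$ is reached (both algorithms are described in the context). Then, with a suitable choice of the parameters of both algorithms, the number of communication rounds needed to reach an $\varepsilon$-solution is $$\mathcal{O}\left(\sqrt{\frac{\delta_f}{\mu}}\log\frac1\varepsilon\right)\ \text{for the nodes from } M_f,\qquad \tilde{\mathcal{O}}\left(\sqrt{\frac{\delta_g}{\mu}}\log\frac1\varepsilon\right)\ \text{for the nodes from } M_g.$$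
   Context: Problem: $\min_{x\in\mathbb{R}^d} h(x)$, $h=f+g$, with $f=\frac{1}{|M_f|}\sum_{m\in M_f}f_m$ and $g=\frac{1}{|M_g|}\sum_{m\in M_g}g_m$, all functions twice differentiable on $\mathbb{R}^d$. $M_f,M_g$ are finite sets of nodes. A server holds $f_1$ and $g_1$. $x_*$ denotes the minimizer of $h$. Norms are Euclidean for vectors and operator (spectral) for matrices. Communication rounds: computations with $f_1,g_1$ are free. Each evaluation of $\nabla f$ (or $\nabla(f-f_1)$) at a point costs one communication round for the nodes of $M_f$; each evaluation of $\nabla g$ (or $\nabla(g-g_1)$) at a point costs one communication round for the nodes of $M_g$; evaluating $\nabla h$ costs one round of each. C-AccExtragradient: input $x_0=\overline{x}_0\in\mathbb{R}^d$; parameters $\tau\in(0,1)$, $\eta,\theta,\alpha>0$, number of iterations $K$. For $k=0,\dots,K-1$: 1. $\underline{x}_k=\tau x_k+(1-\tau)\overline{x}_k$. 2. $\overline{x}_{k+1}\approx\arg\min_x A_\theta^k(x)$, where $A_\theta^k(x)=\langle\nabla(f-f_1)(\underline{x}_k),x\rangle+\frac{1}{2\theta}\|x-\underline{x}_k\|^2+f_1(x)+g(x)$. 3. $x_{k+1}=x_k+\eta\alpha(\overline{x}_{k+1}-x_k)-\eta\nabla h(\overline{x}_{k+1})$. Output $x_K$. AccExtragradient for $A_\theta^k$ (inner algorithm, for fixed $k$, with its own iterates): put $q_g(x)=\langle\nabla(f-f_1)(\underline{x}_k),x\rangle+\frac{1}{2\theta}\|x-\underline{x}_k\|^2+f_1(x)+g_1(x)$,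 so that $A_\theta^k=q_g+(g-g_1)$. Input an initial point $x_0=\overline{x}_0\in\mathbb{R}^d$; parameters $\tau_g\in(0,1)$, $\eta_g,\theta_g,\alpha_g>0$, number of iterations $T$. For $t=0,\dots,T-1$: 1. $\underline{x}_t=\tau_g x_t+(1-\tau_g)\overline{x}_t$. 2. $\overline{x}_{t+1}\approx\arg\min_x B_{\theta_g}^t(x)$, where $B_{\theta_g}^t(x)=\langle\nabla(g-g_1)(\underline{x}_t),x\rangle+\frac{1}{2\theta_g}\|x-\underline{x}_t\|^2+q_g(x)$, solved (without communication) to accuracy $\|\nabla B_{\theta_g}^t(\overline{x}_{t+1})\|^2\le\frac{2}{10\theta_g^2}\|\underline{x}_t-\arg\min_x B_{\theta_g}^t(x)\|^2$. 3. $x_{t+1}=x_t+\eta_g\alpha_g(\overline{x}_{t+1}-x_t)-\eta_g\nabla A_\theta^k(\overline{x}_{t+1})$. Output $\overline{x}_T$, which is used as $\overline{x}_{k+1}$ in the outer algorithm. An $\varepsilon$-solution means that the output satisfies $\mu\|x_K-x_*\|^2\le\varepsilon$. $\mathcal{O}(\cdot)$ hides absolute constants, and $\log\frac1\varepsilon$ is understood up to the dependence of its argument on the initial point (i.e. $\log\frac{C_0}{\varepsilon}$ with $C_0$ determined by the initial error). $\tilde{\mathcal{O}}(\cdot)$ additionally hides logarithmic factors (those arising from solving the subproblems). *)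

theory Defs
  imports "HOL-Analysis.Analysis"
begin

definition grad :: "('a::euclidean_space \<Rightarrow> real) \<Rightarrow> 'a \<Rightarrow> 'a" where
  "grad \<phi> x = (THE D. GDERIV \<phi> x :> D)"

definition hess :: "('a::euclidean_space \<Rightarrow> real) \<Rightarrow> 'a \<Rightarrow> 'a \<Rightarrow> 'a" where
  "hess \<phi> x = frechet_derivative (grad \<phi>) (at x)"

definition twice_differentiable :: "('a::euclidean_space \<Rightarrow> real) \<Rightarrow> bool" where
  "twice_differentiable \<phi> \<longleftrightarrow>
     (\<forall>x. \<phi> differentiable (at x)) \<and> (\<forall>x. grad \<phi> differentiable (at x))"

definition strongly_convex :: "real \<Rightarrow> ('a::euclidean_space \<Rightarrow> real) \<Rightarrow> bool" where
  "strongly_convex \<mu> \<phi> \<longleftrightarrow>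
     (\<forall>x y. \<phi> x \<ge> \<phi> y + grad \<phi> y \<bullet> (x - y) + \<mu> / 2 * (norm (x - y))\<^sup>2)"

abbreviation argmin :: "('a \<Rightarrow> real) \<Rightarrow> 'a" where
  "argmin \<phi> \<equiv> arg_min \<phi> (\<lambda>_. True)"

text \<open>The same four parameters occur in the outer algorithm (\<open>\<tau>, \<eta>, \<theta>, \<alpha>\<close>) and in the inner one
  (\<open>\<tau>\<^sub>g, \<eta>\<^sub>g, \<theta>\<^sub>g, \<alpha>\<^sub>g\<close>).\<close>

record ae_params =
  tau :: real
  eta :: real
  theta :: real
  alpha :: real

definition admissible :: "ae_params \<Rightarrow> bool" where
  "admissible P \<longleftrightarrow> 0 < tau P \<and> tau P < 1 \<and> 0 < eta P \<and> 0 < theta P \<and> 0 < alpha P"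

definition mix :: "ae_params \<Rightarrow> 'a::euclidean_space \<Rightarrow> 'a \<Rightarrow> 'a" where
  "mix P x xb = tau P *\<^sub>R x + (1 - tau P) *\<^sub>R xb"

definition extragrad_step ::
  "ae_params \<Rightarrow> ('a::euclidean_space \<Rightarrow> real) \<Rightarrow> 'a \<Rightarrow> 'a \<Rightarrow> 'a" where
  "extragrad_step P \<phi> x u =
     x + (eta P * alpha P) *\<^sub>R (u - x) - eta P *\<^sub>R grad \<phi> u"

text \<open>\<open>model p q \<theta> y\<close> linearises \<open>p\<close> at \<open>y\<close> (up to a constant), adds the proximal term and
  keeps \<open>q\<close>.\<close>

definition model ::
  "('a::euclidean_space \<Rightarrow> real) \<Rightarrow> ('a \<Rightarrow> real) \<Rightarrow> real \<Rightarrow> 'a \<Rightarrow> 'a \<Rightarrow> real" where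
  "model p q \<theta> y = (\<lambda>x. grad p y \<bullet> x + 1 / (2 * \<theta>) * (norm (x - y))\<^sup>2 + q x)"

text \<open>Below, \<open>y\<close> is the outer extrapolation point \<open>\<tau> x\<^sub>k + (1 - \<tau>) xb\<^sub>k\<close> and \<open>w\<close> the inner one.
  \<open>A_fun = q_fun + (g - g1)\<close>, and \<open>B_fun\<close> linearises the part \<open>g - g1\<close>.\<close>

definition A_fun where
  "A_fun f f1 g \<theta> y = model (\<lambda>x. f x - f1 x) (\<lambda>x. f1 x + g x) \<theta> y"

definition q_fun where
  "q_fun f f1 g1 \<theta> y = model (\<lambda>x. f x - f1 x) (\<lambda>x. f1 x + g1 x) \<theta> y"

definition B_fun where
  "B_fun f f1 g g1 \<theta> y \<theta>g w = model (\<lambda>x. g x - g1 x) (q_fun f f1 g1 \<theta> y) \<theta>g w"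

text \<open>Inner algorithm. The sequences are infinite; the outer algorithm reads them only up to its
  stopping index. Its step 2 is inexact, hence a relation rather than a function.\<close>

definition inner_run ::
  "ae_params \<Rightarrow> ae_params \<Rightarrow> ('a::euclidean_space \<Rightarrow> real) \<Rightarrow> ('a \<Rightarrow> real) \<Rightarrow> ('a \<Rightarrow> real) \<Rightarrow>
   ('a \<Rightarrow> real) \<Rightarrow> 'a \<Rightarrow> 'a \<Rightarrow> (nat \<Rightarrow> 'a) \<Rightarrow> (nat \<Rightarrow> 'a) \<Rightarrow> bool" where
  "inner_run P Q f f1 g g1 y z0 z zb \<longleftrightarrow>
     z 0 = z0 \<and> zb 0 = z0 \<and>
     (\<forall>t. let w = mix Q (z t) (zb t);
              B = B_fun f f1 g g1 (theta P) y (theta Q) w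
          in (norm (grad B (zb (Suc t))))\<^sup>2
               \<le> 2 / (10 * (theta Q)\<^sup>2) * (norm (w - argmin B))\<^sup>2 \<and>
             z (Suc t) = extragrad_step Q (A_fun f f1 g (theta P) y) (z t) (zb (Suc t)))"

definition accurate ::
  "real \<Rightarrow> ('a::euclidean_space \<Rightarrow> real) \<Rightarrow> 'a \<Rightarrow> 'a \<Rightarrow> bool" where
  "accurate \<delta>f A y u \<longleftrightarrow> (norm (grad A u))\<^sup>2 \<le> \<delta>f\<^sup>2 / 3 * (norm (y - argmin A))\<^sup>2"

text \<open>Outer algorithm with \<open>K\<close> iterations. In iteration \<open>k\<close> the inner algorithm, with iterates
  \<open>z k\<close> and \<open>zb k\<close>, starts at the point \<open>y\<close> and is stopped after \<open>T k\<close> iterations, the first time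
  (after at least one iteration) that the required accuracy holds. \<open>LEAST\<close> is unspecified if that
  never happens, so termination has to be asserted separately (\<open>inner_terminates\<close>).\<close>

definition inner_terminates ::
  "real \<Rightarrow> ae_params \<Rightarrow> ('a::euclidean_space \<Rightarrow> real) \<Rightarrow> ('a \<Rightarrow> real) \<Rightarrow> ('a \<Rightarrow> real) \<Rightarrow> 'a \<Rightarrow>
   (nat \<Rightarrow> 'a) \<Rightarrow> bool" where
  "inner_terminates \<delta>f P f f1 g y zb \<longleftrightarrow>
     (\<exists>t\<ge>1. accurate \<delta>f (A_fun f f1 g (theta P) y) y (zb t))"

definition outer_run ::
  "real \<Rightarrow> ae_params \<Rightarrow> ae_params \<Rightarrow> ('a::euclidean_space \<Rightarrow> real) \<Rightarrow> ('a \<Rightarrow> real) \<Rightarrow> ('a \<Rightarrow> real) \<Rightarrow>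
   ('a \<Rightarrow> real) \<Rightarrow> 'a \<Rightarrow> nat \<Rightarrow> (nat \<Rightarrow> 'a) \<Rightarrow> (nat \<Rightarrow> 'a) \<Rightarrow>
   (nat \<Rightarrow> nat \<Rightarrow> 'a) \<Rightarrow> (nat \<Rightarrow> nat \<Rightarrow> 'a) \<Rightarrow> (nat \<Rightarrow> nat) \<Rightarrow> bool" where
  "outer_run \<delta>f P Q f f1 g g1 x0 K x xb z zb T \<longleftrightarrow>
     x 0 = x0 \<and> xb 0 = x0 \<and>
     (\<forall>k<K. let y = mix P (x k) (xb k)
            in inner_run P Q f f1 g g1 y y (z k) (zb k) \<and>
               T k = (LEAST t. 1 \<le> t \<and> accurate \<delta>f (A_fun f f1 g (theta P) y) y (zb k t)) \<and>
               xb (Suc k) = zb k (T k) \<and>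
               x (Suc k) = extragrad_step P (\<lambda>v. f v + g v) (x k) (xb (Suc k)))"

text \<open>Rounds for the \<open>f\<close>-nodes in one outer iteration: one for the gradient of \<open>f - f1\<close> at the
  extrapolation point (a constant vector throughout the inner algorithm, hence evaluated once) and
  one for the gradient of \<open>h\<close>.\<close>

definition rounds_f :: "nat \<Rightarrow> nat" where
  "rounds_f K = (\<Sum>k<K. 1 + 1)"

text \<open>Rounds for the \<open>g\<close>-nodes in one outer iteration: in each of the \<open>T k\<close> inner iterations one
  for the gradient of \<open>g - g1\<close> (defining \<open>B_fun\<close>) and one for the gradient of \<open>A_fun\<close>, which
  contains that of \<open>g\<close>; then one for the gradient of \<open>h\<close>. The accuracy test after an inner
  iteration uses the gradient of \<open>A_fun\<close> already computed in it.\<close>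

definition rounds_g :: "nat \<Rightarrow> (nat \<Rightarrow> nat) \<Rightarrow> nat" where
  "rounds_g K T = (\<Sum>k<K. (\<Sum>t<T k. 1 + 1) + 1)"

text \<open>The constant hidden in the big-O. It has to be independent of the dimension too, which an
  existential quantifier inside a statement polymorphic in the space would not express; hence a
  (generous) numeral.\<close>

definition abs_const :: real where
  "abs_const = 1000000"

end

theory Submission
  imports Defs
begin

text \<open>
Both algorithms are one and the same method, applied to a splitting \<open>H = p + q\<close> of a
\<open>\<sigma>\<close>-strongly convex function in which \<open>\<nabla>p\<close> is \<open>\<delta>\<close>-Lipschitz; both parts may be nonconvex, and
the gradient of \<open>q\<close> may grow arbitrarily fast. For the outer algorithm \<open>H = h\<close>, \<open>p = f - f\<^sub>1\<close>,
\<open>\<sigma> = \<mu>\<close>, \<open>\<delta> = \<delta>\<^sub>f\<close>; for the inner one \<open>H = A\<^sub>\<theta>\<^sup>k\<close>, \<open>p = g - g\<^sub>1\<close>, \<open>\<sigma> = \<delta>\<^sub>f\<close>, \<open>\<delta> = \<delta>\<^sub>g\<close>. The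
similarity of the Hessians enters only as the Lipschitz bound for \<open>\<nabla>p\<close>. It makes \<open>q = H - p\<close>
convex up to a defect \<open>\<delta>\<close>, which the proximal term of the model absorbs as soon as
\<open>1 / \<theta> > \<delta>\<close>; this is why models have unique minimizers although their parts are nonconvex.

An approximate minimizer \<open>u\<close> of the model at \<open>w\<close> is an approximate proximal step for \<open>H\<close>: the
stopping tests make \<open>\<theta> \<nabla>H(u)\<close> differ from \<open>w - u\<close> by at most \<open>\<parallel>w - u\<parallel>\<close>, that is,
\<open>\<theta> \<parallel>\<nabla>H(u)\<parallel>\<^sup>2 \<le> 2 \<langle>\<nabla>H(u), w - u\<rangle>\<close> (\<open>inexact_prox\<close>). With \<open>\<tau> = \<surd>(\<theta>\<sigma>) / 2\<close> this inequality
and strong convexity give a potential that falls by the factor \<open>1 - \<tau>\<close> in every iteration and,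
in addition, pays for \<open>\<theta>/2 \<parallel>\<nabla>H(u)\<parallel>\<^sup>2\<close> (\<open>potential_step\<close>). In the outer algorithm
\<open>1 / \<tau> \<approx> \<surd>(\<delta>\<^sub>f / \<mu>)\<close>, which bounds the number of outer iterations.

In the inner algorithm \<open>1 / \<tau> \<approx> \<surd>(\<delta>\<^sub>g / \<delta>\<^sub>f)\<close>, and the extra gradient term turns the decay of the
potential into decay of \<open>\<parallel>\<nabla>A\<parallel>\<close>, which the accuracy test measures. That test compares with
the distance of the starting point \<open>y\<close> from the minimizer, whereas the initial potential contains
\<open>A(y) - min A\<close>, which that distance does not control, since \<open>\<nabla>A\<close> has no Lipschitz bound. However, the first
iteration is a proximal step from \<open>y\<close> itself, and afterwards the potential is
bounded by \<open>8/\<theta>\<close> times the squared distance (\<open>potential_after_first_step\<close>). Hence the accuracy is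
reached within \<open>O(\<surd>(\<delta>\<^sub>g / \<delta>\<^sub>f) (1 + ln (\<delta>\<^sub>g / \<delta>\<^sub>f)))\<close> inner iterations, and multiplying by the number
of outer iterations gives \<open>\<surd>(\<delta>\<^sub>g / \<mu>)\<close> up to the logarithm.
\<close>

section \<open>Gradients\<close>

lemma GDERIV_unique:
  assumes "GDERIV \<phi> x :> a" "GDERIV \<phi> x :> b"
  shows "a = b"
proof -
  have "(\<lambda>v. v \<bullet> a) = (\<lambda>v. v \<bullet> b)"
    using assms has_derivative_unique unfolding gderiv_def by blast
  then have "v \<bullet> a = v \<bullet> b" for v by meson
  then have "\<forall>v. v \<bullet> a = v \<bullet> b" by blast
  then show ?thesis by (simp only: vector_eq_ldot)
qed

lemma grad_eq: "GDERIV \<phi> x :> D \<Longrightarrow> grad \<phi> x = D"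
  unfolding grad_def by (rule the_equality) (auto intro: GDERIV_unique)

lemma GDERIV_grad:
  fixes \<phi> :: "'a::euclidean_space \<Rightarrow> real"
  assumes "\<phi> differentiable (at x)"
  shows "GDERIV \<phi> x :> grad \<phi> x"
proof -
  obtain L where L: "(\<phi> has_derivative L) (at x)"
    using assms by (auto simp: differentiable_def)
  interpret L: bounded_linear L using L by (rule has_derivative_bounded_linear)
  define D where "D = (\<Sum>b\<in>Basis. L b *\<^sub>R b)"
  have "L v = v \<bullet> D" for v
  proof -
    have "L v = L (\<Sum>b\<in>Basis. (v \<bullet> b) *\<^sub>R b)" by (simp add: euclidean_representation)
    also have "\<dots> = (\<Sum>b\<in>Basis. (v \<bullet> b) * L b)" by (simp add: L.sum L.scaleR)
    also have "\<dots> = v \<bullet> D" by (simp add: D_def inner_sum_right mult.commute)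
    finally show ?thesis .
  qed
  then have "L = (\<lambda>v. v \<bullet> D)" by (rule ext)
  then have "GDERIV \<phi> x :> D" using L by (simp only: gderiv_def)
  then show ?thesis by (simp add: grad_eq)
qed

lemma GDERIV_differentiable: "GDERIV \<phi> x :> D \<Longrightarrow> \<phi> differentiable (at x)"
  unfolding gderiv_def differentiable_def by blast

lemma GDERIV_scaled_sum:
  assumes "finite M" "\<And>m. m \<in> M \<Longrightarrow> GDERIV (\<phi> m) x :> D m"
  shows "GDERIV (\<lambda>x. c * (\<Sum>m\<in>M. \<phi> m x)) x :> c *\<^sub>R (\<Sum>m\<in>M. D m)"
  using assms unfolding gderiv_def
  by (auto intro!: derivative_eq_intros simp: inner_sum_right)

lemma twice_differentiable_scaled_sum:
  fixes \<phi> :: "nat \<Rightarrow> 'a::euclidean_space \<Rightarrow> real"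
  assumes "finite M" "\<And>m. m \<in> M \<Longrightarrow> twice_differentiable (\<phi> m)"
  shows "twice_differentiable (\<lambda>x. c * (\<Sum>m\<in>M. \<phi> m x))"
proof -
  have D: "GDERIV (\<lambda>x. c * (\<Sum>m\<in>M. \<phi> m x)) x :> c *\<^sub>R (\<Sum>m\<in>M. grad (\<phi> m) x)" for x
    using assms by (intro GDERIV_scaled_sum GDERIV_grad) (auto simp: twice_differentiable_def)
  then have "grad (\<lambda>x. c * (\<Sum>m\<in>M. \<phi> m x)) = (\<lambda>x. c *\<^sub>R (\<Sum>m\<in>M. grad (\<phi> m) x))"
    using grad_eq by blast
  moreover have "(\<lambda>x. c *\<^sub>R (\<Sum>m\<in>M. grad (\<phi> m) x)) differentiable (at x)" for x
    using assms by (intro differentiable_scaleR differentiable_sum differentiable_const)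
      (auto simp: twice_differentiable_def)
  ultimately show ?thesis
    using D GDERIV_differentiable unfolding twice_differentiable_def by metis
qed

lemma grad_diff_lipschitz_of_hess:
  fixes \<phi> \<psi> :: "'a::euclidean_space \<Rightarrow> real"
  assumes "twice_differentiable \<phi>" "twice_differentiable \<psi>"
    and bound: "\<And>x. onorm (\<lambda>v. hess \<psi> x v - hess \<phi> x v) \<le> \<delta>"
  shows "norm (grad (\<lambda>x. \<phi> x - \<psi> x) x - grad (\<lambda>x. \<phi> x - \<psi> x) y) \<le> \<delta> * norm (x - y)"
proof -
  have "grad (\<lambda>x. \<phi> x - \<psi> x) x = grad \<phi> x - grad \<psi> x" for x
    using assms by (intro grad_eq GDERIV_diff GDERIV_grad) (auto simp: twice_differentiable_def)
  moreover have "norm ((grad \<psi> x - grad \<phi> x) - (grad \<psi> y - grad \<phi> y)) \<le> \<delta> * norm (x - y)"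
  proof (rule differentiable_bound[of UNIV "\<lambda>x. grad \<psi> x - grad \<phi> x"
        "\<lambda>x v. hess \<psi> x v - hess \<phi> x v"])
    show "((\<lambda>x. grad \<psi> x - grad \<phi> x) has_derivative (\<lambda>v. hess \<psi> z v - hess \<phi> z v))
        (at z within UNIV)" for z
      using assms unfolding hess_def twice_differentiable_def
      by (auto intro!: has_derivative_diff simp flip: frechet_derivative_works)
  qed (use bound in auto)
  moreover have "grad \<phi> x - grad \<psi> x - (grad \<phi> y - grad \<psi> y)
      = - ((grad \<psi> x - grad \<phi> x) - (grad \<psi> y - grad \<phi> y))" by simp
  ultimately show ?thesis by (simp only: norm_minus_cancel)
qed

section \<open>Strong convexity, possibly with negative modulus\<close>

lemma strongly_convexD:
  fixes F :: "'a::euclidean_space \<Rightarrow> real"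
  shows "strongly_convex m F \<Longrightarrow> F x \<ge> F y + grad F y \<bullet> (x - y) + m / 2 * (norm (x - y))\<^sup>2"
  by (simp add: strongly_convex_def)

lemma strongly_convex_mono:
  fixes F :: "'a::euclidean_space \<Rightarrow> real"
  assumes "strongly_convex m F" "m' \<le> m"
  shows "strongly_convex m' F"
  unfolding strongly_convex_def
proof (intro allI)
  fix x y :: 'a
  have "m' / 2 * (norm (x - y))\<^sup>2 \<le> m / 2 * (norm (x - y))\<^sup>2"
    using assms(2) by (intro mult_right_mono) auto
  then show "F x \<ge> F y + grad F y \<bullet> (x - y) + m' / 2 * (norm (x - y))\<^sup>2"
    using strongly_convexD[OF assms(1), of y x] by linarith
qed

text \<open>Along the segment from \<open>y\<close> to \<open>x\<close>, a \<open>\<delta>\<close>-Lipschitz gradient keeps the slope of \<open>p\<close> within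
  \<open>t \<delta> \<parallel>x - y\<parallel>\<^sup>2\<close> of its initial value, so that \<open>p\<close> minus the quadratic upper model is
  nonincreasing in \<open>t\<close>.\<close>

lemma lipschitz_grad_upper_bound:
  fixes p :: "'a::euclidean_space \<Rightarrow> real"
  assumes diff: "\<And>x. p differentiable (at x)"
    and lip: "\<And>x y. norm (grad p x - grad p y) \<le> \<delta> * norm (x - y)"
  shows "p x \<le> p y + grad p y \<bullet> (x - y) + \<delta> / 2 * (norm (x - y))\<^sup>2"
proof -
  define d where "d = x - y"
  define \<phi> where "\<phi> = (\<lambda>t. p (y + t *\<^sub>R d) - t * (grad p y \<bullet> d) - \<delta> / 2 * t\<^sup>2 * (norm d)\<^sup>2)"
  have "\<phi> 1 \<le> \<phi> 0"
  proof (rule DERIV_nonpos_imp_nonincreasing[of 0 1 \<phi>])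
    fix t :: real assume t: "0 \<le> t" "t \<le> 1"
    have "(p has_derivative (\<lambda>v. v \<bullet> grad p (y + t *\<^sub>R d))) (at (y + t *\<^sub>R d))"
      using GDERIV_grad[OF diff] by (simp add: gderiv_def)
    then have "((\<lambda>t. p (y + t *\<^sub>R d)) has_derivative (\<lambda>s. (s *\<^sub>R d) \<bullet> grad p (y + t *\<^sub>R d))) (at t)"
      by (intro has_derivative_compose[of "\<lambda>t. y + t *\<^sub>R d" _ t UNIV p, simplified])
        (auto intro!: derivative_eq_intros)
    then have "((\<lambda>t. p (y + t *\<^sub>R d)) has_field_derivative d \<bullet> grad p (y + t *\<^sub>R d)) (at t)"
      by (simp add: has_field_derivative_def mult.commute[of _ "d \<bullet> _"])
    then have "(\<phi> has_field_derivative
        d \<bullet> grad p (y + t *\<^sub>R d) - grad p y \<bullet> d - \<delta> * t * (norm d)\<^sup>2) (at t)"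
      unfolding \<phi>_def by (auto intro!: derivative_eq_intros)
    moreover have "d \<bullet> grad p (y + t *\<^sub>R d) - grad p y \<bullet> d - \<delta> * t * (norm d)\<^sup>2 \<le> 0"
    proof -
      have "d \<bullet> grad p (y + t *\<^sub>R d) - grad p y \<bullet> d = (grad p (y + t *\<^sub>R d) - grad p y) \<bullet> d"
        by (simp add: inner_diff_left inner_commute[of d])
      also have "\<dots> \<le> norm (grad p (y + t *\<^sub>R d) - grad p y) * norm d"
        by (rule norm_cauchy_schwarz)
      also have "\<dots> \<le> (\<delta> * norm (t *\<^sub>R d)) * norm d"
        using lip[of "y + t *\<^sub>R d" y] by (intro mult_right_mono) auto
      also have "\<dots> = \<delta> * t * (norm d)\<^sup>2" using t by (simp add: power2_eq_square)
      finally show ?thesis by simp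
    qed
    ultimately show "\<exists>z. (\<phi> has_real_derivative z) (at t) \<and> z \<le> 0" by blast
  qed simp
  then show ?thesis by (simp add: \<phi>_def d_def)
qed

text \<open>Since \<open>p\<close> curves upwards by at most \<open>\<delta>\<close>, it accounts for at most \<open>\<delta>\<close> of the modulus of
  \<open>p + q\<close>.\<close>

lemma strongly_convex_remove_lipschitz_part:
  fixes p q :: "'a::euclidean_space \<Rightarrow> real"
  assumes "\<And>x. p differentiable (at x)" "\<And>x. q differentiable (at x)"
    and "\<And>x y. norm (grad p x - grad p y) \<le> \<delta> * norm (x - y)"
    and sc: "strongly_convex m (\<lambda>x. p x + q x)"
  shows "strongly_convex (m - \<delta>) q"
  unfolding strongly_convex_def
proof (intro allI)
  fix x y :: 'a
  have "grad (\<lambda>x. p x + q x) y = grad p y + grad q y"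
    using assms by (intro grad_eq GDERIV_add GDERIV_grad) auto
  then have "p x + q x \<ge> p y + q y + (grad p y + grad q y) \<bullet> (x - y) + m / 2 * (norm (x - y))\<^sup>2"
    using strongly_convexD[OF sc, of y x] by simp
  moreover have "p x \<le> p y + grad p y \<bullet> (x - y) + \<delta> / 2 * (norm (x - y))\<^sup>2"
    using assms by (intro lipschitz_grad_upper_bound)
  ultimately show "q x \<ge> q y + grad q y \<bullet> (x - y) + (m - \<delta>) / 2 * (norm (x - y))\<^sup>2"
    by (simp add: inner_add_left diff_divide_distrib left_diff_distrib)
qed

text \<open>The quadratic lower bound at the origin exceeds \<open>F 0\<close> outside the ball of radius \<open>R\<close>, so a
  minimizer over this ball, which exists by compactness, is a global one.\<close>

lemma strongly_convex_ex1_min: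
  fixes F :: "'a::euclidean_space \<Rightarrow> real"
  assumes diff: "\<And>x. F differentiable (at x)" and sc: "strongly_convex m F" and m: "0 < m"
  shows "\<exists>!u. is_arg_min F (\<lambda>_. True) u" "grad F (argmin F) = 0"
proof -
  define R where "R = 2 * norm (grad F 0) / m"
  have R: "R \<ge> 0" using m by (simp add: R_def)
  have "continuous_on (cball 0 R) F"
    using diff by (intro differentiable_imp_continuous_on)
      (auto simp: differentiable_on_def intro: differentiable_at_withinI)
  then obtain u where u: "u \<in> cball 0 R" "\<And>x. x \<in> cball 0 R \<Longrightarrow> F u \<le> F x"
    using continuous_attains_inf[of "cball (0::'a) R" F] R compact_cball cball_eq_empty
    by (metis not_le)
  have outside: "F u \<le> F x" if "x \<notin> cball 0 R" for x
  proof -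
    have "norm (grad F 0) \<le> m / 2 * norm x"
    proof -
      have "R < norm x" using that by (simp add: not_le)
      then have "m / 2 * R \<le> m / 2 * norm x" using m by (intro mult_left_mono) auto
      then show ?thesis using m by (simp add: R_def)
    qed
    then have "norm (grad F 0) * norm x \<le> (m / 2 * norm x) * norm x"
      by (intro mult_right_mono) auto
    then have "norm (grad F 0) * norm x \<le> m / 2 * (norm x)\<^sup>2"
      by (simp only: power2_eq_square mult.assoc)
    moreover have "grad F 0 \<bullet> x \<ge> - (norm (grad F 0) * norm x)"
      using Cauchy_Schwarz_ineq2[of "grad F 0" x] by linarith
    ultimately have "F 0 \<le> F x" using strongly_convexD[OF sc, of 0 x] by simp
    then show ?thesis using u(2)[of 0] R by simp
  qed
  have min: "is_arg_min F (\<lambda>_. True) u"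
    unfolding is_arg_min_linorder using u(2) outside by blast
  have zero: "grad F v = 0" if "is_arg_min F (\<lambda>_. True) v" for v
  proof -
    have "(\<lambda>z. z \<bullet> grad F v) = (\<lambda>z. 0)"
      using that GDERIV_grad[OF diff, of v] unfolding gderiv_def is_arg_min_linorder
      by (intro differential_zero_maxmin[of v UNIV F]) auto
    then have "grad F v \<bullet> grad F v = 0" by (rule fun_cong)
    then show ?thesis by simp
  qed
  have "v = u" if "is_arg_min F (\<lambda>_. True) v" for v
  proof -
    have "m / 2 * (norm (v - u))\<^sup>2 \<le> 0"
    proof -
      have "F v \<le> F u" using that by (simp only: is_arg_min_linorder)
      then show ?thesis using strongly_convexD[OF sc, of u v] zero[OF min] by simp
    qed
    then show ?thesis using m by (simp add: mult_le_0_iff)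
  qed
  with min show ex1: "\<exists>!u. is_arg_min F (\<lambda>_. True) u" by blast
  show "grad F (argmin F) = 0"
    unfolding arg_min_def by (rule zero, rule someI[of "is_arg_min F (\<lambda>_. True)"], rule min)
qed

lemma strongly_convex_quadratic_growth:
  fixes F :: "'a::euclidean_space \<Rightarrow> real"
  assumes "\<And>x. F differentiable (at x)" "strongly_convex m F" "0 < m"
  shows "F x \<ge> F (argmin F) + m / 2 * (norm (x - argmin F))\<^sup>2"
  using strongly_convexD[OF assms(2), of "argmin F" x] strongly_convex_ex1_min(2)[OF assms] by simp

lemma strongly_convex_dist_argmin_le_grad:
  fixes F :: "'a::euclidean_space \<Rightarrow> real"
  assumes "\<And>x. F differentiable (at x)" "strongly_convex m F" "0 < m"
  shows "m * norm (x - argmin F) \<le> norm (grad F x)"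
proof (cases "x = argmin F")
  case False
  let ?s = "argmin F"
  have "m * (norm (x - ?s))\<^sup>2 \<le> grad F x \<bullet> (x - ?s)"
    using strongly_convexD[OF assms(2), of x ?s] strongly_convex_quadratic_growth[OF assms, of x]
    by (simp add: norm_minus_commute inner_diff_right)
  also have "\<dots> \<le> norm (grad F x) * norm (x - ?s)" by (rule norm_cauchy_schwarz)
  finally show ?thesis using False by (simp add: power2_eq_square)
qed simp

lemma GDERIV_model:
  fixes q :: "'a::euclidean_space \<Rightarrow> real"
  assumes "q differentiable (at x)"
  shows "GDERIV (model p q \<theta> y) x :> grad p y + (1 / \<theta>) *\<^sub>R (x - y) + grad q x"
proof -
  have "GDERIV (\<lambda>x. grad p y \<bullet> x + c * ((x - y) \<bullet> (x - y))) x :> grad p y + (2 * c) *\<^sub>R (x - y)" for c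
    unfolding gderiv_def
    by (auto intro!: derivative_eq_intros
        simp: inner_add_right inner_diff_right inner_diff_left inner_commute algebra_simps)
  from this[of "1 / (2 * \<theta>)"]
  have "GDERIV (\<lambda>x. grad p y \<bullet> x + 1 / (2 * \<theta>) * ((x - y) \<bullet> (x - y))) x :>
      grad p y + (1 / \<theta>) *\<^sub>R (x - y)" by simp
  from GDERIV_add[OF this GDERIV_grad[OF assms]] show ?thesis
    by (simp add: model_def power2_norm_eq_inner)
qed

lemma strongly_convex_model:
  fixes q :: "'a::euclidean_space \<Rightarrow> real"
  assumes "\<And>x. q differentiable (at x)" "strongly_convex m q"
  shows "strongly_convex (1 / \<theta> + m) (model p q \<theta> y)"
  unfolding strongly_convex_def
proof (intro allI)
  fix x z :: 'a
  have "(norm (x - y))\<^sup>2 = (norm (z - y))\<^sup>2 + 2 * ((z - y) \<bullet> (x - z)) + (norm (x - z))\<^sup>2"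
    unfolding power2_norm_eq_inner
    by (simp add: inner_diff_left inner_diff_right inner_commute algebra_simps)
  then have "1 / (2 * \<theta>) * (norm (x - y))\<^sup>2 = 1 / (2 * \<theta>) * (norm (z - y))\<^sup>2
      + 1 / \<theta> * ((z - y) \<bullet> (x - z)) + 1 / \<theta> / 2 * (norm (x - z))\<^sup>2"
    by (simp add: distrib_left add_divide_distrib)
  then show "model p q \<theta> y x \<ge> model p q \<theta> y z + grad (model p q \<theta> y) z \<bullet> (x - z)
      + (1 / \<theta> + m) / 2 * (norm (x - z))\<^sup>2"
    using strongly_convexD[OF assms(2), of z x]
    unfolding grad_eq[OF GDERIV_model[OF assms(1)]] unfolding model_def
    by (simp add: inner_add_left inner_diff_right add_divide_distrib diff_divide_distrib
        distrib_right)
qed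

section \<open>The accelerated extragradient method for a composite function\<close>

text \<open>The potential argument needs \<open>2 \<eta> \<alpha> \<le> 1\<close> and \<open>2 \<eta> \<tau> \<le> \<theta>\<close>. With \<open>\<alpha> = \<sigma>\<close> and \<open>\<eta> = \<tau> / \<sigma>\<close> these
  read \<open>2 \<tau> \<le> 1\<close> and \<open>2 \<tau>\<^sup>2 \<le> \<theta> \<sigma>\<close>. The second one holds with a factor 2 to spare for
  \<open>\<tau> = \<surd>(\<theta>\<sigma>) / 2\<close>, and this surplus is the multiple of \<open>\<parallel>\<nabla>H(u)\<parallel>\<^sup>2\<close> from which the inner algorithm
  reads off its gradient bound.\<close>

definition tuned :: "real \<Rightarrow> real \<Rightarrow> ae_params" where
  "tuned \<theta> \<sigma> = \<lparr>tau = sqrt (\<theta> * \<sigma>) / 2, eta = sqrt (\<theta> * \<sigma>) / 2 / \<sigma>, theta = \<theta>, alpha = \<sigma>\<rparr>"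

lemma tuned_simps [simp]:
  "tau (tuned \<theta> \<sigma>) = sqrt (\<theta> * \<sigma>) / 2" "eta (tuned \<theta> \<sigma>) = sqrt (\<theta> * \<sigma>) / 2 / \<sigma>"
  "theta (tuned \<theta> \<sigma>) = \<theta>" "alpha (tuned \<theta> \<sigma>) = \<sigma>"
  by (simp_all add: tuned_def)

text \<open>The bound \<open>\<theta> \<delta> < 1\<close> makes the proximal term dominate the nonconvexity of \<open>q\<close>, and
  \<open>\<theta> \<sigma> \<le> 1\<close> gives \<open>\<tau> \<le> 1/2\<close>.\<close>

locale composite =
  fixes H p q :: "'a::euclidean_space \<Rightarrow> real" and \<sigma> \<delta> \<theta> :: real
  assumes H_eq: "H = (\<lambda>x. p x + q x)"
    and p_diff: "\<And>x. p differentiable (at x)"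
    and q_diff: "\<And>x. q differentiable (at x)"
    and lip: "\<And>x y. norm (grad p x - grad p y) \<le> \<delta> * norm (x - y)"
    and sc: "strongly_convex \<sigma> H"
    and \<sigma>: "0 < \<sigma>" and \<theta>: "0 < \<theta>"
    and \<theta>\<delta>: "\<theta> * \<delta> < 1" and \<theta>\<sigma>: "\<theta> * \<sigma> \<le> 1"
begin

abbreviation "s \<equiv> argmin H"
definition "\<tau> = sqrt (\<theta> * \<sigma>) / 2"

lemma \<tau>: "0 < \<tau>" "\<tau> \<le> 1 / 2" "4 * \<tau>\<^sup>2 = \<theta> * \<sigma>"
proof -
  show "0 < \<tau>" using \<theta> \<sigma> by (simp add: \<tau>_def)
  have "sqrt (\<theta> * \<sigma>) \<le> 1" using \<theta>\<sigma> by simp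
  then show "\<tau> \<le> 1 / 2" by (simp add: \<tau>_def)
  show "4 * \<tau>\<^sup>2 = \<theta> * \<sigma>" using \<theta> \<sigma> by (simp add: \<tau>_def power_divide)
qed

lemma inverse_\<tau>_le:
  assumes "1 / (\<theta> * \<sigma>) \<le> c\<^sup>2 * r" "0 \<le> c"
  shows "1 / \<tau> \<le> 2 * c * sqrt r"
proof -
  have "1 / \<tau> = 2 * sqrt (1 / (\<theta> * \<sigma>))" by (simp add: \<tau>_def real_sqrt_divide)
  also have "\<dots> \<le> 2 * sqrt (c\<^sup>2 * r)" using assms(1) by simp
  also have "\<dots> = 2 * c * sqrt r" using assms(2) by (simp add: real_sqrt_mult)
  finally show ?thesis .
qed

lemma admissible_tuned: "admissible (tuned \<theta> \<sigma>)"
  using \<tau>(1,2) \<theta> \<sigma> by (simp add: admissible_def flip: \<tau>_def)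

lemma GDERIV_H: "GDERIV H x :> grad p x + grad q x"
  unfolding H_eq by (intro GDERIV_add GDERIV_grad p_diff q_diff)

lemma grad_H: "grad H x = grad p x + grad q x"
  using GDERIV_H by (rule grad_eq)

lemma H_diff: "H differentiable (at x)"
  using GDERIV_H by (rule GDERIV_differentiable)

lemma H_growth: "H x \<ge> H s + \<sigma> / 2 * (norm (x - s))\<^sup>2"
  using H_diff sc \<sigma> by (rule strongly_convex_quadratic_growth)

lemma model_diff: "model p q \<theta> w differentiable (at x)"
  using GDERIV_model[OF q_diff] by (rule GDERIV_differentiable)

lemma model_strongly_convex: "strongly_convex (1 / \<theta> + \<sigma> - \<delta>) (model p q \<theta> w)"
proof -
  have "strongly_convex (\<sigma> - \<delta>) q"
    using p_diff q_diff lip sc[unfolded H_eq] by (rule strongly_convex_remove_lipschitz_part)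
  from strongly_convex_model[OF q_diff this] show ?thesis by (simp add: add_diff_eq)
qed

lemma inverse_\<theta>_gt: "0 < 1 / \<theta> - \<delta>"
  using \<theta> \<theta>\<delta> by (simp add: field_simps)

lemma model_ex1_min: "\<exists>!u. is_arg_min (model p q \<theta> w) (\<lambda>_. True) u"
  using strongly_convex_ex1_min(1)[OF model_diff model_strongly_convex] inverse_\<theta>_gt \<sigma> by simp

text \<open>With \<open>m = 1/\<theta> - \<delta>\<close>, the model is \<open>m\<close>-strongly convex, so the tolerance \<open>4 c \<le> m\<^sup>2\<close> places \<open>u\<close>
  at most half as far from the exact minimizer as \<open>w\<close> is. Therefore \<open>\<parallel>w - u\<parallel>\<close> bounds half that
  distance, and the error \<open>m \<parallel>w - u\<parallel>\<close> of the model's gradient and the error \<open>\<delta> \<parallel>w - u\<parallel>\<close> of the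
  linearisation add up to exactly \<open>\<parallel>w - u\<parallel> / \<theta>\<close>.\<close>

lemma inexact_prox:
  assumes acc: "(norm (grad (model p q \<theta> w) u))\<^sup>2 \<le> c * (norm (w - argmin (model p q \<theta> w)))\<^sup>2"
    and c: "4 * c \<le> (1 / \<theta> - \<delta>)\<^sup>2"
  shows "\<theta> * (norm (grad H u))\<^sup>2 \<le> 2 * (grad H u \<bullet> (w - u))"
proof -
  define m where "m = 1 / \<theta> - \<delta>"
  let ?B = "model p q \<theta> w" and ?G = "grad H u"
  let ?b = "argmin ?B"
  have m: "0 < m" unfolding m_def by (rule inverse_\<theta>_gt)
  have "(2 * norm (grad ?B u))\<^sup>2 \<le> 4 * c * (norm (w - ?b))\<^sup>2"
    using acc by (simp add: power_mult_distrib)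
  also have "\<dots> \<le> m\<^sup>2 * (norm (w - ?b))\<^sup>2" using c by (intro mult_right_mono) (auto simp: m_def)
  finally have "(2 * norm (grad ?B u))\<^sup>2 \<le> (m * norm (w - ?b))\<^sup>2" by (simp add: power_mult_distrib)
  then have half: "2 * norm (grad ?B u) \<le> m * norm (w - ?b)"
    by (rule power2_le_imp_le) (use m in simp)
  have "strongly_convex m ?B"
    using model_strongly_convex by (rule strongly_convex_mono) (use \<sigma> in \<open>simp add: m_def\<close>)
  then have "m * norm (u - ?b) \<le> norm (grad ?B u)"
    using model_diff m by (intro strongly_convex_dist_argmin_le_grad)
  with half have "m * (2 * norm (u - ?b)) \<le> m * norm (w - ?b)" by linarith
  then have "2 * norm (u - ?b) \<le> norm (w - ?b)" using m by simp
  moreover have "norm (w - ?b) \<le> norm (w - u) + norm (u - ?b)"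
    using norm_triangle_ineq[of "w - u" "u - ?b"] by simp
  ultimately have "m * norm (w - ?b) \<le> m * (2 * norm (w - u))"
    using m by (intro mult_left_mono) auto
  with half have gB: "norm (grad ?B u) \<le> m * norm (w - u)" by linarith
  have "?G - (1 / \<theta>) *\<^sub>R (w - u) = grad ?B u + (grad p u - grad p w)"
    by (simp add: grad_H grad_eq[OF GDERIV_model[OF q_diff]] algebra_simps)
  then have "norm (?G - (1 / \<theta>) *\<^sub>R (w - u)) \<le> norm (grad ?B u) + norm (grad p u - grad p w)"
    by (metis norm_triangle_ineq)
  also have "\<dots> \<le> m * norm (w - u) + \<delta> * norm (w - u)"
    using gB lip[of u w] by (intro add_mono) (auto simp: norm_minus_commute)
  also have "\<dots> = norm ((1 / \<theta>) *\<^sub>R (w - u))"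
    using \<theta> by (simp add: m_def flip: distrib_right)
  finally have "(norm (?G - (1 / \<theta>) *\<^sub>R (w - u)))\<^sup>2 \<le> (norm ((1 / \<theta>) *\<^sub>R (w - u)))\<^sup>2"
    by (intro power_mono) auto
  then have "?G \<bullet> ?G \<le> 2 * (1 / \<theta>) * (?G \<bullet> (w - u))"
    unfolding power2_norm_eq_inner
    by (simp add: inner_diff_left inner_diff_right inner_commute diff_divide_distrib)
  then show ?thesis using \<theta> by (simp add: power2_norm_eq_inner field_simps)
qed

definition potential :: "'a \<Rightarrow> 'a \<Rightarrow> real" where
  "potential x xb = \<sigma> * (norm (x - s))\<^sup>2 + 2 * (H xb - H s)"

lemma potential_ge:
  "\<sigma> * (norm (x - s))\<^sup>2 \<le> potential x xb" "2 * (H xb - H s) \<le> potential x xb"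
  "0 \<le> potential x xb"
proof -
  have "0 \<le> \<sigma> * (norm (xb - s))\<^sup>2 / 2" "0 \<le> \<sigma> * (norm (x - s))\<^sup>2" using \<sigma> by simp_all
  then show "\<sigma> * (norm (x - s))\<^sup>2 \<le> potential x xb" "2 * (H xb - H s) \<le> potential x xb"
    "0 \<le> potential x xb"
    using H_growth[of xb] by (auto simp: potential_def)
qed

text \<open>The vector \<open>\<tau> (x - s)\<close> is split as \<open>\<tau> (u - s) + (w - u) - (1 - \<tau>) (xb - u)\<close>. Pairing its parts
  with \<open>\<nabla>H(u)\<close>, strong convexity handles the first, the proximal inequality the second, and
  convexity the third.\<close>

lemma potential_step:
  assumes w: "w = mix (tuned \<theta> \<sigma>) x xb"
    and prox: "\<theta> * (norm (grad H u))\<^sup>2 \<le> 2 * (grad H u \<bullet> (w - u))"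
  shows "potential (extragrad_step (tuned \<theta> \<sigma>) H x u) u + \<theta> / 2 * (norm (grad H u))\<^sup>2
    \<le> (1 - \<tau>) * potential x xb"
proof -
  let ?x' = "extragrad_step (tuned \<theta> \<sigma>) H x u"
  define G where "G = grad H u"
  define a where "a = (u - x) - (1 / \<sigma>) *\<^sub>R G"
  have x': "?x' - s = (x - s) + \<tau> *\<^sub>R a"
    using \<sigma> by (simp add: extragrad_step_def a_def G_def \<tau>_def algebra_simps)
  have sq: "(norm (?x' - s))\<^sup>2 = (norm (x - s))\<^sup>2 + 2 * \<tau> * ((x - s) \<bullet> a) + \<tau>\<^sup>2 * (norm a)\<^sup>2"
    unfolding x' power2_norm_eq_inner
    by (simp add: inner_add_left inner_add_right inner_commute power2_eq_square)
  have cross: "2 * ((x - s) \<bullet> (u - x)) = (norm (u - s))\<^sup>2 - (norm (x - s))\<^sup>2 - (norm (u - x))\<^sup>2"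
    unfolding power2_norm_eq_inner by (simp add: inner_diff_left inner_diff_right inner_commute)
  have split: "\<tau> * (G \<bullet> (x - s)) = \<tau> * (G \<bullet> (u - s)) + G \<bullet> (w - u) - (1 - \<tau>) * (G \<bullet> (xb - u))"
  proof -
    have "\<tau> *\<^sub>R (x - s) = \<tau> *\<^sub>R (u - s) + (w - u) - (1 - \<tau>) *\<^sub>R (xb - u)"
      by (simp add: w mix_def \<tau>_def algebra_simps)
    from arg_cong[OF this, of "\<lambda>v. G \<bullet> v"] show ?thesis
      by (simp only: inner_scaleR_right inner_add_right inner_diff_right)
  qed
  have a_sq: "(norm a)\<^sup>2 \<le> 2 * (norm (u - x))\<^sup>2 + 2 / \<sigma>\<^sup>2 * (norm G)\<^sup>2"
  proof -
    have "0 \<le> (norm ((u - x) + (1 / \<sigma>) *\<^sub>R G))\<^sup>2" by simp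
    then show ?thesis
      unfolding a_def power2_norm_eq_inner
      by (simp add: inner_add_left inner_add_right inner_diff_left inner_diff_right inner_commute
          power2_eq_square diff_divide_distrib)
  qed
  have "\<sigma> * (\<tau>\<^sup>2 * (norm a)\<^sup>2) \<le> \<sigma> * (\<tau>\<^sup>2 * (2 * (norm (u - x))\<^sup>2 + 2 / \<sigma>\<^sup>2 * (norm G)\<^sup>2))"
    using a_sq \<sigma> by (intro mult_left_mono) auto
  also have "\<dots> = 2 * \<tau> * (\<tau> * \<sigma> * (norm (u - x))\<^sup>2) + 2 * \<tau>\<^sup>2 / \<sigma> * (norm G)\<^sup>2"
    using \<sigma> by (simp add: power2_eq_square field_simps)
  also have "\<dots> \<le> 1 * (\<tau> * \<sigma> * (norm (u - x))\<^sup>2) + 2 * \<tau>\<^sup>2 / \<sigma> * (norm G)\<^sup>2"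
    using \<tau> \<sigma> by (intro add_mono mult_right_mono) auto
  also have "2 * \<tau>\<^sup>2 / \<sigma> = \<theta> / 2" using \<tau>(3) \<sigma> by (simp add: field_simps)
  finally have a_le: "\<sigma> * (\<tau>\<^sup>2 * (norm a)\<^sup>2) \<le> \<tau> * \<sigma> * (norm (u - x))\<^sup>2 + \<theta> / 2 * (norm G)\<^sup>2"
    by simp
  have "(x - s) \<bullet> a = (x - s) \<bullet> (u - x) - (1 / \<sigma>) * (G \<bullet> (x - s))"
    by (simp add: a_def inner_diff_right[of "x - s"] inner_commute)
  then have "\<sigma> * ((x - s) \<bullet> a) = \<sigma> * ((x - s) \<bullet> (u - x)) - G \<bullet> (x - s)"
    using \<sigma> by (simp add: right_diff_distrib)
  then have "2 * \<tau> * (\<sigma> * ((x - s) \<bullet> a)) = 2 * \<tau> * (\<sigma> * ((x - s) \<bullet> (u - x)) - G \<bullet> (x - s))"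
    by (rule arg_cong)
  then have lin: "\<sigma> * (2 * \<tau> * ((x - s) \<bullet> a))
      = \<tau> * \<sigma> * (2 * ((x - s) \<bullet> (u - x))) - 2 * (\<tau> * (G \<bullet> (x - s)))"
    by (simp only: right_diff_distrib mult_ac)
  have main: "\<sigma> * (norm (?x' - s))\<^sup>2 = \<sigma> * (norm (x - s))\<^sup>2
      + \<tau> * \<sigma> * (norm (u - s))\<^sup>2 - \<tau> * \<sigma> * (norm (x - s))\<^sup>2 - \<tau> * \<sigma> * (norm (u - x))\<^sup>2
      - 2 * (\<tau> * (G \<bullet> (x - s))) + \<sigma> * (\<tau>\<^sup>2 * (norm a)\<^sup>2)"
    unfolding sq distrib_left lin cross by (simp add: right_diff_distrib)
  have "\<tau> * (H u - H s + \<sigma> / 2 * (norm (u - s))\<^sup>2) \<le> \<tau> * (G \<bullet> (u - s))"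
    using strongly_convexD[OF sc, of u s] \<tau>
    by (intro mult_left_mono) (auto simp: G_def inner_diff_right norm_minus_commute)
  then have at_s: "\<tau> * (H u - H s) + \<tau> * \<sigma> * (norm (u - s))\<^sup>2 / 2 \<le> \<tau> * (G \<bullet> (u - s))"
    by (simp add: distrib_left)
  have "0 \<le> \<sigma> / 2 * (norm (xb - u))\<^sup>2" using \<sigma> by simp
  then have "G \<bullet> (xb - u) \<le> H xb - H u"
    using strongly_convexD[OF sc, of u xb] by (simp add: G_def)
  then have at_xb: "(1 - \<tau>) * (G \<bullet> (xb - u)) \<le> (1 - \<tau>) * (H xb - H u)"
    using \<tau> by (intro mult_left_mono) auto
  have "\<sigma> * (norm (?x' - s))\<^sup>2 + 2 * (H u - H s) + \<theta> / 2 * (norm G)\<^sup>2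
      \<le> \<sigma> * (norm (x - s))\<^sup>2 - \<tau> * \<sigma> * (norm (x - s))\<^sup>2
        + 2 * ((1 - \<tau>) * (H xb - H u)) - 2 * (\<tau> * (H u - H s)) + 2 * (H u - H s)"
    using main a_le split at_s at_xb prox by (simp add: G_def)
  also have "\<dots> = (1 - \<tau>) * potential x xb" by (simp add: potential_def algebra_simps)
  finally show ?thesis by (simp add: potential_def G_def)
qed

text \<open>A run of either algorithm, its inexact minimization reduced to the proximal inequality of
  \<open>inexact_prox\<close>.\<close>

definition prox_run :: "nat \<Rightarrow> (nat \<Rightarrow> 'a) \<Rightarrow> (nat \<Rightarrow> 'a) \<Rightarrow> bool" where
  "prox_run K x xb \<longleftrightarrow> (\<forall>k<K.
     \<theta> * (norm (grad H (xb (Suc k))))\<^sup>2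
       \<le> 2 * (grad H (xb (Suc k)) \<bullet> (mix (tuned \<theta> \<sigma>) (x k) (xb k) - xb (Suc k))) \<and>
     x (Suc k) = extragrad_step (tuned \<theta> \<sigma>) H (x k) (xb (Suc k)))"

lemma prox_run_step:
  assumes "prox_run K x xb" "k < K"
  shows "potential (x (Suc k)) (xb (Suc k)) + \<theta> / 2 * (norm (grad H (xb (Suc k))))\<^sup>2
    \<le> (1 - \<tau>) * potential (x k) (xb k)"
  using assms potential_step unfolding prox_run_def by metis

lemma prox_run_potential:
  assumes "prox_run (i + K) x xb"
  shows "potential (x (i + K)) (xb (i + K)) \<le> (1 - \<tau>) ^ K * potential (x i) (xb i)"
  using assms
proof (induction K)
  case (Suc K)
  have "prox_run (i + K) x xb" using Suc.prems by (simp add: prox_run_def)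
  have "potential (x (i + Suc K)) (xb (i + Suc K)) \<le> (1 - \<tau>) * potential (x (i + K)) (xb (i + K))"
    using prox_run_step[OF Suc.prems, of "i + K"] \<theta>
      zero_le_power2[of "norm (grad H (xb (Suc (i + K))))"]
    by (smt (verit) add_Suc_right divide_pos_pos lessI mult_nonneg_nonneg)
  also have "\<dots> \<le> (1 - \<tau>) * ((1 - \<tau>) ^ K * potential (x i) (xb i))"
    using Suc.IH \<open>prox_run (i + K) x xb\<close> \<tau> by (intro mult_left_mono) auto
  finally show ?case by (simp add: mult.assoc)
qed simp

text \<open>Started at \<open>x = xb = y\<close>, the first iteration is a proximal step from \<open>y\<close> itself. Convexity
  at \<open>u\<close> compares \<open>H(u)\<close> with \<open>H(s)\<close> directly, so that \<open>H(y)\<close> does not appear.\<close>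

lemma potential_after_first_step:
  assumes prox: "\<theta> * (norm (grad H u))\<^sup>2 \<le> 2 * (grad H u \<bullet> (y - u))"
  shows "potential (extragrad_step (tuned \<theta> \<sigma>) H y u) u \<le> 8 / \<theta> * (norm (y - s))\<^sup>2"
proof -
  define G d where "G = grad H u" and "d = norm (y - s)"
  let ?x' = "extragrad_step (tuned \<theta> \<sigma>) H y u"
  have "H s \<ge> H u + G \<bullet> (s - u)"
    using strongly_convexD[OF strongly_convex_mono[OF sc, of 0], of u s] \<sigma> by (simp add: G_def)
  then have "H u - H s \<le> G \<bullet> (y - s) - G \<bullet> (y - u)" by (simp add: inner_diff_right)
  also have "\<dots> \<le> norm G * d - \<theta> / 2 * (norm G)\<^sup>2"
    using prox norm_cauchy_schwarz[of G "y - s"] by (simp add: G_def d_def)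
  finally have gap: "H u - H s \<le> norm G * d - \<theta> / 2 * (norm G)\<^sup>2" .
  (* Completing the square in norm G. *)
  have "0 \<le> (d - \<theta> * norm G)\<^sup>2 / (2 * \<theta>)" using \<theta> by simp
  also have "\<dots> = d\<^sup>2 / (2 * \<theta>) - (norm G * d - \<theta> / 2 * (norm G)\<^sup>2)"
    using \<theta> by (simp add: power2_eq_square field_simps)
  finally have gap': "H u - H s \<le> d\<^sup>2 / (2 * \<theta>)" using gap by linarith
  have "0 \<le> \<sigma> / 2 * (norm (u - s))\<^sup>2" using \<sigma> by simp
  then have "\<theta> / 2 * (norm G)\<^sup>2 \<le> norm G * d" using gap H_growth[of u] by linarith
  then have "norm G * (\<theta> * norm G) \<le> norm G * (2 * d)" by (simp add: power2_eq_square mult_ac)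
  then have G_le: "\<theta> * norm G \<le> 2 * d"
    by (cases "G = 0") (auto simp: d_def mult_le_cancel_left)
  have "\<sigma> / 2 * (norm (u - s))\<^sup>2 \<le> d\<^sup>2 / (2 * \<theta>)" using H_growth[of u] gap' by linarith
  then have "(\<theta> * \<sigma>) * (norm (u - s))\<^sup>2 \<le> d\<^sup>2" using \<theta> by (simp add: field_simps)
  then have "(2 * \<tau> * norm (u - s))\<^sup>2 \<le> d\<^sup>2" by (simp add: power_mult_distrib \<tau>(3)[symmetric])
  then have u_le: "2 * \<tau> * norm (u - s) \<le> d" using power2_le_imp_le[of _ d] by (simp add: d_def)
  have "?x' - s = (1 - \<tau>) *\<^sub>R (y - s) + \<tau> *\<^sub>R (u - s) - (\<tau> / \<sigma>) *\<^sub>R G"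
    using \<sigma> by (simp add: extragrad_step_def G_def \<tau>_def algebra_simps)
  then have "norm (?x' - s) \<le> norm ((1 - \<tau>) *\<^sub>R (y - s)) + norm (\<tau> *\<^sub>R (u - s)) + norm ((\<tau> / \<sigma>) *\<^sub>R G)"
    using norm_triangle_ineq4[of "(1 - \<tau>) *\<^sub>R (y - s) + \<tau> *\<^sub>R (u - s)" "(\<tau> / \<sigma>) *\<^sub>R G"]
      norm_triangle_ineq[of "(1 - \<tau>) *\<^sub>R (y - s)" "\<tau> *\<^sub>R (u - s)"] by (simp only:)
  also have "\<dots> = (1 - \<tau>) * d + \<tau> * norm (u - s) + \<tau> / \<sigma> * norm G"
    using \<tau> \<sigma> by (simp add: d_def)
  finally have "\<tau> * norm (?x' - s) \<le> \<tau> * ((1 - \<tau>) * d + \<tau> * norm (u - s) + \<tau> / \<sigma> * norm G)"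
    using \<tau> by (intro mult_left_mono) auto
  also have "\<dots> = \<tau> * ((1 - \<tau>) * d + \<tau> * norm (u - s)) + \<tau>\<^sup>2 / \<sigma> * norm G"
    by (simp add: power2_eq_square algebra_simps)
  also have "\<dots> \<le> 1 / 2 * (1 * d + d / 2) + d / 2"
  proof (intro add_mono mult_mono)
    have "\<tau>\<^sup>2 / \<sigma> = \<theta> / 4" using \<tau>(3) \<sigma> by (simp add: field_simps)
    then show "\<tau>\<^sup>2 / \<sigma> * norm G \<le> d / 2" using G_le by (simp only:)
  qed (use \<tau> u_le in \<open>auto simp: d_def\<close>)
  finally have "\<tau> * norm (?x' - s) \<le> 5 / 4 * d" by simp
  then have "(\<tau> * norm (?x' - s))\<^sup>2 \<le> (5 / 4 * d)\<^sup>2" using \<tau> by (intro power_mono) auto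
  then have "\<theta> * \<sigma> * (norm (?x' - s))\<^sup>2 \<le> 25 / 4 * d\<^sup>2"
    by (simp add: power_mult_distrib power_divide \<tau>(3)[symmetric])
  moreover have "\<theta> * (2 * (H u - H s)) \<le> d\<^sup>2" using gap' \<theta> by (simp add: field_simps)
  moreover have "\<theta> * potential ?x' u = \<theta> * \<sigma> * (norm (?x' - s))\<^sup>2 + \<theta> * (2 * (H u - H s))"
    by (simp add: potential_def distrib_left)
  ultimately have "\<theta> * potential ?x' u \<le> 25 / 4 * d\<^sup>2 + d\<^sup>2" by linarith
  also have "\<dots> \<le> 8 * d\<^sup>2" by simp
  finally show ?thesis using \<theta> by (simp add: d_def field_simps)
qed

text \<open>The first iteration serves to bound the potential by the squared distance, and the gradient
  at the next point is the first one paid for by that bound. The exponent may then be taken as \<open>n\<close>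
  rather than \<open>n + 1\<close>.\<close>

lemma prox_run_grad_decay:
  assumes run: "\<And>K. prox_run K x xb" and start: "x 0 = y" "xb 0 = y"
  shows "(norm (grad H (xb (Suc (Suc n)))))\<^sup>2 \<le> 16 / \<theta>\<^sup>2 * (1 - \<tau>) ^ n * (norm (y - s))\<^sup>2"
proof -
  have "mix (tuned \<theta> \<sigma>) (x 0) (xb 0) = y" by (simp add: start mix_def flip: scaleR_left_distrib)
  then have "potential (x 1) (xb 1) \<le> 8 / \<theta> * (norm (y - s))\<^sup>2"
    using run[of 1] potential_after_first_step[of "xb 1" y] by (simp add: prox_run_def start)
  then have "(1 - \<tau>) ^ n * potential (x 1) (xb 1) \<le> (1 - \<tau>) ^ n * (8 / \<theta> * (norm (y - s))\<^sup>2)"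
    using \<tau> by (intro mult_left_mono) auto
  with prox_run_potential[OF run, of 1 n]
  have V: "potential (x (Suc n)) (xb (Suc n)) \<le> (1 - \<tau>) ^ n * (8 / \<theta> * (norm (y - s))\<^sup>2)"
    by simp
  have "(1 - \<tau>) * potential (x (Suc n)) (xb (Suc n)) \<le> 1 * potential (x (Suc n)) (xb (Suc n))"
    using \<tau> potential_ge(3) by (intro mult_right_mono) auto
  then have "\<theta> / 2 * (norm (grad H (xb (Suc (Suc n)))))\<^sup>2 \<le> (1 - \<tau>) ^ n * (8 / \<theta> * (norm (y - s))\<^sup>2)"
    using prox_run_step[OF run, of "Suc n" "Suc (Suc n)"] V
      potential_ge(3)[of "x (Suc (Suc n))" "xb (Suc (Suc n))"] by linarith
  then show ?thesis using \<theta> by (simp add: field_simps power2_eq_square)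
qed

end

lemma geometric_iterations:
  fixes \<tau> C \<epsilon> X :: real
  assumes \<tau>: "0 < \<tau>" "\<tau> \<le> 1" and C: "0 \<le> C" and \<epsilon>: "0 < \<epsilon>" and X: "ln (C / \<epsilon>) \<le> X" "0 \<le> X"
  shows "\<exists>n. (1 - \<tau>) ^ n * C \<le> \<epsilon> \<and> real n \<le> X / \<tau> + 1"
proof -
  define n where "n = nat \<lceil>X / \<tau>\<rceil>"
  have n: "X / \<tau> \<le> real n" "real n \<le> X / \<tau> + 1"
    using \<tau> X by (auto simp: n_def of_nat_nat real_nat_ceiling_ge)
  have "(1 - \<tau>) ^ n * C \<le> \<epsilon>"
  proof (cases "C = 0")
    case False
    have "(1 - \<tau>) ^ n \<le> exp (- \<tau>) ^ n"
      using \<tau> exp_ge_add_one_self[of "- \<tau>"] by (intro power_mono) auto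
    also have "\<dots> = exp (- (\<tau> * real n))" by (simp add: mult.commute flip: exp_of_nat_mult)
    also have "\<dots> \<le> exp (- ln (C / \<epsilon>))" using n(1) X \<tau> by (simp add: field_simps)
    also have "\<dots> = \<epsilon> / C" using C \<epsilon> False by (simp add: exp_minus)
    finally show ?thesis using C False by (simp add: field_simps)
  qed (use \<epsilon> in simp)
  with n show ?thesis by blast
qed

section \<open>Communication complexity\<close>

theorem theorem4:
  fixes fs gs :: "nat \<Rightarrow> 'a::euclidean_space \<Rightarrow> real"
    and Mf Mg :: "nat set"
    and f g h :: "'a \<Rightarrow> real"
    and \<mu> \<delta>f \<delta>g :: real
  assumes "finite Mf" "finite Mg" "1 \<in> Mf" "1 \<in> Mg"
    and "\<And>m. m \<in> Mf \<Longrightarrow> twice_differentiable (fs m)"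
    and "\<And>m. m \<in> Mg \<Longrightarrow> twice_differentiable (gs m)"
    and "f = (\<lambda>x. 1 / real (card Mf) * (\<Sum>m\<in>Mf. fs m x))"
    and "g = (\<lambda>x. 1 / real (card Mg) * (\<Sum>m\<in>Mg. gs m x))"
    and "h = (\<lambda>x. f x + g x)"
    and "strongly_convex \<mu> h"
    and "convex_on UNIV g"
    and "\<And>x. onorm (\<lambda>v. hess (fs 1) x v - hess f x v) \<le> \<delta>f"
    and "\<And>x. onorm (\<lambda>v. hess (gs 1) x v - hess g x v) \<le> \<delta>g"
    and "0 < \<mu>" "\<mu> < \<delta>f" "\<delta>f < \<delta>g"
  shows "\<exists>P Q. admissible P \<and> admissible Q \<and>
    (\<forall>y. \<exists>!u. is_arg_min (A_fun f (fs 1) g (theta P) y) (\<lambda>_. True) u) \<and>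
    (\<forall>y w. \<exists>!u. is_arg_min (B_fun f (fs 1) g (gs 1) (theta P) y (theta Q) w) (\<lambda>_. True) u) \<and>
    (\<forall>x0 \<epsilon>. 0 < \<epsilon> \<longrightarrow>
      (let C0 = \<mu> * (norm (x0 - argmin h))\<^sup>2 + (h x0 - h (argmin h));
           L = max 0 (ln (C0 / \<epsilon>))
       in \<exists>K. \<forall>x xb z zb T. outer_run \<delta>f P Q f (fs 1) g (gs 1) x0 K x xb z zb T \<longrightarrow>
            (\<forall>k<K. inner_terminates \<delta>f P f (fs 1) g (mix P (x k) (xb k)) (zb k)) \<and>
            \<mu> * (norm (x K - argmin h))\<^sup>2 \<le> \<epsilon> \<and>
            real (rounds_f K) \<le> abs_const * (sqrt (\<delta>f / \<mu>) * L) \<and>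
            real (rounds_g K T) \<le> abs_const * (sqrt (\<delta>g / \<mu>) * L * (1 + ln (\<delta>g / \<delta>f)))))"
proof -
  (* 1 / theta = 3 df leaves A with modulus 2 df + mu, which is at least df, and the tolerance
     df^2 / 3 of the outer test satisfies 4 / 3 <= (3 - 1)^2 as inexact_prox demands. The inner
     choice 1 / theta = 10 dg is explained where the inner test is used. *)
  define P where "P = tuned (1 / (3 * \<delta>f)) \<mu>"
  define Q where "Q = tuned (1 / (10 * \<delta>g)) \<delta>f"
  define f1 g1 where "f1 = fs 1" and "g1 = gs 1"
  define \<Lambda> where "\<Lambda> = ln (\<delta>g / \<delta>f)"
  note pos = \<open>0 < \<mu>\<close> \<open>\<mu> < \<delta>f\<close> \<open>\<delta>f < \<delta>g\<close>
  have \<Lambda>: "0 \<le> \<Lambda>" using pos by (simp add: \<Lambda>_def)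
  have "twice_differentiable f"
    unfolding assms(7) using assms(1,5) by (rule twice_differentiable_scaled_sum)
  moreover have "twice_differentiable g"
    unfolding assms(8) using assms(2,6) by (rule twice_differentiable_scaled_sum)
  moreover have "twice_differentiable f1" "twice_differentiable g1"
    using assms(3-6) by (auto simp: f1_def g1_def)
  ultimately have tw: "twice_differentiable f" "twice_differentiable g"
    "twice_differentiable f1" "twice_differentiable g1" by auto
  then have diff: "f differentiable (at x)" "g differentiable (at x)"
    "f1 differentiable (at x)" "g1 differentiable (at x)" for x
    by (auto simp: twice_differentiable_def)

  interpret outer: composite h "\<lambda>x. f x - f1 x" "\<lambda>x. f1 x + g x" \<mu> \<delta>f "1 / (3 * \<delta>f)"
  proof
    show "norm (grad (\<lambda>x. f x - f1 x) x - grad (\<lambda>x. f x - f1 x) y) \<le> \<delta>f * norm (x - y)" for x y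
      using tw assms(12) by (intro grad_diff_lipschitz_of_hess) (auto simp: f1_def)
  qed (use assms(9,10) diff pos in \<open>auto intro!: differentiable_diff differentiable_add\<close>)

  define A where "A = A_fun f f1 g (1 / (3 * \<delta>f))"
  define qf where "qf = q_fun f f1 g1 (1 / (3 * \<delta>f))"
  have A: "A = model (\<lambda>x. f x - f1 x) (\<lambda>x. f1 x + g x) (1 / (3 * \<delta>f))"
    by (simp add: fun_eq_iff A_def A_fun_def)
  have inner: "composite (A y) (\<lambda>x. g x - g1 x) (qf y) \<delta>f \<delta>g (1 / (10 * \<delta>g))" for y
  proof
    show "A y = (\<lambda>x. g x - g1 x + qf y x)"
      by (simp add: fun_eq_iff A_def qf_def A_fun_def q_fun_def model_def)
    show "norm (grad (\<lambda>x. g x - g1 x) x - grad (\<lambda>x. g x - g1 x) z) \<le> \<delta>g * norm (x - z)" for x z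
      using tw assms(13) by (intro grad_diff_lipschitz_of_hess) (auto simp: g1_def)
    show "qf y differentiable (at x)" for x
      unfolding qf_def q_fun_def using diff
      by (intro GDERIV_differentiable[OF GDERIV_model] differentiable_add)
    show "strongly_convex \<delta>f (A y)"
      unfolding A using outer.model_strongly_convex
      by (rule strongly_convex_mono) (use pos in simp)
  qed (use diff pos in \<open>auto intro!: differentiable_diff simp: field_simps\<close>)

  have inner_count: "\<exists>t\<ge>1. accurate \<delta>f (A y) y (zb t) \<and> real t \<le> 116 * (1 + \<Lambda>) * sqrt (\<delta>g / \<delta>f)"
    if run: "inner_run P Q f f1 g g1 y y z zb" for y z zb
  proof -
    interpret I: composite "A y" "\<lambda>x. g x - g1 x" "qf y" \<delta>f \<delta>g "1 / (10 * \<delta>g)" by (rule inner)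
    have "I.prox_run K z zb" for K
      unfolding I.prox_run_def
    proof (intro allI impI conjI)
      fix k
      let ?w = "mix Q (z k) (zb k)"
      have step: "(norm (grad (model (\<lambda>x. g x - g1 x) (qf y) (1 / (10 * \<delta>g)) ?w) (zb (Suc k))))\<^sup>2
          \<le> 2 / (10 * (1 / (10 * \<delta>g))\<^sup>2)
            * (norm (?w - argmin (model (\<lambda>x. g x - g1 x) (qf y) (1 / (10 * \<delta>g)) ?w)))\<^sup>2"
        "z (Suc k) = extragrad_step Q (A y) (z k) (zb (Suc k))"
        using run unfolding inner_run_def Let_def B_fun_def A_def qf_def
        by (simp_all add: P_def Q_def)
      show "z (Suc k) = extragrad_step (tuned (1 / (10 * \<delta>g)) \<delta>f) (A y) (z k) (zb (Suc k))"
        using step(2) by (simp add: Q_def)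
      (* With 1 / theta = 10 dg the tolerance 2 / (10 theta^2) equals 20 dg^2, and
         4 * 20 <= (10 - 1)^2. *)
      have "4 * (2 / (10 * (1 / (10 * \<delta>g))\<^sup>2)) \<le> (1 / (1 / (10 * \<delta>g)) - \<delta>g)\<^sup>2"
        using pos by (simp add: power2_eq_square)
      from I.inexact_prox[OF step(1) this]
      show "1 / (10 * \<delta>g) * (norm (grad (A y) (zb (Suc k))))\<^sup>2
          \<le> 2 * (grad (A y) (zb (Suc k))
            \<bullet> (mix (tuned (1 / (10 * \<delta>g)) \<delta>f) (z k) (zb k) - zb (Suc k)))"
        by (simp add: Q_def)
    qed
    then have decay: "(norm (grad (A y) (zb (Suc (Suc n)))))\<^sup>2
        \<le> 16 / (1 / (10 * \<delta>g))\<^sup>2 * (1 - I.\<tau>) ^ n * (norm (y - argmin (A y)))\<^sup>2" for n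
      using run by (intro I.prox_run_grad_decay[of z zb]) (auto simp: inner_run_def)
    (* 16 / theta^2 = 1600 dg^2 has to be brought down to df^2 / 3. *)
    have "ln (1600 * \<delta>g\<^sup>2 / (\<delta>f\<^sup>2 / 3)) = ln (4800 * (\<delta>g / \<delta>f)\<^sup>2)"
      by (simp add: power_divide)
    also have "\<dots> = ln 4800 + 2 * \<Lambda>"
      using pos by (simp add: ln_mult ln_realpow \<Lambda>_def)
    also have "ln 4800 \<le> ln ((2::real) ^ 13)" by simp
    also have "ln ((2::real) ^ 13) = 13 * ln 2" by (subst ln_realpow) simp_all
    also have "13 * ln 2 \<le> 13 * (1::real)" using ln_le_minus_one[of "2::real"] by simp
    finally have "ln (1600 * \<delta>g\<^sup>2 / (\<delta>f\<^sup>2 / 3)) \<le> 13 * (1 + \<Lambda>)" using \<Lambda> by simp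
    then obtain n where n: "(1 - I.\<tau>) ^ n * (1600 * \<delta>g\<^sup>2) \<le> \<delta>f\<^sup>2 / 3"
      "real n \<le> 13 * (1 + \<Lambda>) / I.\<tau> + 1"
      using geometric_iterations[of I.\<tau> "1600 * \<delta>g\<^sup>2" "\<delta>f\<^sup>2 / 3"] I.\<tau> \<Lambda> pos by force
    have "accurate \<delta>f (A y) y (zb (n + 2))"
    proof -
      have "16 / (1 / (10 * \<delta>g))\<^sup>2 * (1 - I.\<tau>) ^ n \<le> \<delta>f\<^sup>2 / 3"
        using n(1) by (simp add: power2_eq_square mult_ac)
      from mult_right_mono[OF this, of "(norm (y - argmin (A y)))\<^sup>2"] decay[of n]
      show ?thesis by (simp add: accurate_def)
    qed
    moreover have "real (n + 2) \<le> 116 * (1 + \<Lambda>) * sqrt (\<delta>g / \<delta>f)"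
    proof -
      have "3 / 2 * 2 \<le> 3 / 2 * ((1 + \<Lambda>) * (1 / I.\<tau>))"
        using I.\<tau> \<Lambda> mult_mono[of 1 "1 + \<Lambda>" 2 "1 / I.\<tau>"] by (simp add: field_simps)
      moreover have "real n \<le> 13 * ((1 + \<Lambda>) * (1 / I.\<tau>)) + 1" using n(2) by simp
      ultimately have "real n + 2 \<le> 29 / 2 * ((1 + \<Lambda>) * (1 / I.\<tau>))" by linarith
      then have "real (n + 2) \<le> 29 / 2 * (1 + \<Lambda>) * (1 / I.\<tau>)"
        by (simp only: of_nat_add of_nat_numeral mult.assoc)
      also have "\<dots> \<le> 29 / 2 * (1 + \<Lambda>) * (2 * 4 * sqrt (\<delta>g / \<delta>f))"
        using \<Lambda> pos by (intro mult_left_mono I.inverse_\<tau>_le) (auto simp: field_simps)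
      also have "\<dots> = 116 * (1 + \<Lambda>) * sqrt (\<delta>g / \<delta>f)" by (simp add: algebra_simps)
      finally show ?thesis .
    qed
    ultimately show ?thesis by (intro exI[of _ "n + 2"]) simp
  qed

  have complexity: "\<exists>K. \<forall>x xb z zb T. outer_run \<delta>f P Q f f1 g g1 x0 K x xb z zb T \<longrightarrow>
      (\<forall>k<K. inner_terminates \<delta>f P f f1 g (mix P (x k) (xb k)) (zb k)) \<and>
      \<mu> * (norm (x K - argmin h))\<^sup>2 \<le> \<epsilon> \<and>
      real (rounds_f K) \<le> abs_const * (sqrt (\<delta>f / \<mu>) * L) \<and>
      real (rounds_g K T) \<le> abs_const * (sqrt (\<delta>g / \<mu>) * L * (1 + ln (\<delta>g / \<delta>f)))"
    if \<epsilon>: "0 < \<epsilon>" and C0: "C0 = \<mu> * (norm (x0 - argmin h))\<^sup>2 + (h x0 - h (argmin h))"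
      and L: "L = max 0 (ln (C0 / \<epsilon>))" for x0 \<epsilon> C0 L
  proof (cases "\<mu> * (norm (x0 - argmin h))\<^sup>2 \<le> \<epsilon>")
    case True
    have "0 \<le> L" by (simp add: L)
    then show ?thesis
      using True \<Lambda> pos by (intro exI[of _ 0])
        (auto simp: outer_run_def rounds_f_def rounds_g_def abs_const_def \<Lambda>_def)
  next
    case False
    (* The objective gap contributes at least mu/2 |x0 - s|^2 to C0, so log (C0 / eps) is bounded
       away from 0 and absorbs the roundings. *)
    have C0_ge: "3 / 2 * \<epsilon> \<le> C0" using False outer.H_growth[of x0] by (simp add: C0)
    have "1 / 3 \<le> ln (3 / 2 :: real)"
      using ln_le_minus_one[of "2 / 3 :: real"] by (simp add: ln_div)
    also have "\<dots> \<le> ln (C0 / \<epsilon>)" using C0_ge \<epsilon> by (subst ln_le_cancel_iff) (auto simp: field_simps)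
    finally have L_ge: "1 / 3 \<le> L" "ln (C0 / \<epsilon>) = L" by (auto simp: L)
    have "ln (2 * C0 / \<epsilon>) = ln 2 + L"
      using C0_ge \<epsilon> ln_mult[of 2 "C0 / \<epsilon>"] L_ge(2) by simp
    also have "\<dots> \<le> 4 * L" using L_ge(1) ln_le_minus_one[of "2::real"] by simp
    finally obtain K where K: "(1 - outer.\<tau>) ^ K * (2 * C0) \<le> \<epsilon>" "real K \<le> 4 * L / outer.\<tau> + 1"
      using geometric_iterations[of outer.\<tau> "2 * C0" \<epsilon> "4 * L"] outer.\<tau> L_ge C0_ge \<epsilon> by force
    have K_le: "real K \<le> 22 * L * sqrt (\<delta>f / \<mu>)"
    proof -
      have "1 / 2 * 2 \<le> 3 / 2 * (L * (1 / outer.\<tau>))"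
        using outer.\<tau> L_ge mult_mono[of "1 / 3" L 2 "1 / outer.\<tau>"] by (simp add: field_simps)
      moreover have "real K \<le> 4 * (L * (1 / outer.\<tau>)) + 1" using K(2) by simp
      ultimately have "real K \<le> 11 / 2 * (L * (1 / outer.\<tau>))" by linarith
      then have "real K \<le> 11 / 2 * L * (1 / outer.\<tau>)" by (simp only: mult.assoc)
      also have "\<dots> \<le> 11 / 2 * L * (2 * 2 * sqrt (\<delta>f / \<mu>))"
        using L_ge pos by (intro mult_left_mono outer.inverse_\<tau>_le) (auto simp: field_simps)
      also have "\<dots> = 22 * L * sqrt (\<delta>f / \<mu>)" by simp
      finally show ?thesis .
    qed
    show ?thesis
    proof (intro exI[of _ K] allI impI)
      fix x xb z zb T
      assume run: "outer_run \<delta>f P Q f f1 g g1 x0 K x xb z zb T"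
      let ?y = "\<lambda>k. mix P (x k) (xb k)"
      have step: "inner_run P Q f f1 g g1 (?y k) (?y k) (z k) (zb k)"
        "T k = (LEAST t. 1 \<le> t \<and> accurate \<delta>f (A (?y k)) (?y k) (zb k t))"
        "xb (Suc k) = zb k (T k)" "x (Suc k) = extragrad_step P h (x k) (xb (Suc k))" if "k < K" for k
        using run that unfolding outer_run_def Let_def A_def \<open>h = (\<lambda>x. f x + g x)\<close>
        by (simp_all add: P_def)
      have T: "1 \<le> T k" "accurate \<delta>f (A (?y k)) (?y k) (xb (Suc k))"
        "real (T k) \<le> 116 * (1 + \<Lambda>) * sqrt (\<delta>g / \<delta>f)"
        "inner_terminates \<delta>f P f f1 g (?y k) (zb k)" if k: "k < K" for k
      proof -
        obtain t where t: "1 \<le> t" "accurate \<delta>f (A (?y k)) (?y k) (zb k t)"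
          "real t \<le> 116 * (1 + \<Lambda>) * sqrt (\<delta>g / \<delta>f)"
          using inner_count[OF step(1)[OF k]] by blast
        show "inner_terminates \<delta>f P f f1 g (?y k) (zb k)"
          using t unfolding inner_terminates_def A_def by (auto simp: P_def)
        have "1 \<le> T k \<and> accurate \<delta>f (A (?y k)) (?y k) (zb k (T k))"
          unfolding step(2)[OF k] by (rule LeastI[of _ t]) (use t in blast)
        then show "1 \<le> T k" "accurate \<delta>f (A (?y k)) (?y k) (xb (Suc k))"
          using step(3)[OF k] by auto
        have "T k \<le> t" unfolding step(2)[OF k] by (rule Least_le) (use t in blast)
        then show "real (T k) \<le> 116 * (1 + \<Lambda>) * sqrt (\<delta>g / \<delta>f)" using t(3) by linarith
      qed
      have "outer.prox_run K x xb"
        unfolding outer.prox_run_def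
      proof (intro allI impI conjI)
        fix k assume k: "k < K"
        show "x (Suc k) = extragrad_step (tuned (1 / (3 * \<delta>f)) \<mu>) h (x k) (xb (Suc k))"
          using step(4)[OF k] by (simp add: P_def)
        have "4 * (\<delta>f\<^sup>2 / 3) \<le> (1 / (1 / (3 * \<delta>f)) - \<delta>f)\<^sup>2"
          using pos by (simp add: power2_eq_square)
        from outer.inexact_prox[OF T(2)[OF k, unfolded accurate_def A] this]
        show "1 / (3 * \<delta>f) * (norm (grad h (xb (Suc k))))\<^sup>2
            \<le> 2 * (grad h (xb (Suc k))
              \<bullet> (mix (tuned (1 / (3 * \<delta>f)) \<mu>) (x k) (xb k) - xb (Suc k)))"
          by (simp add: P_def)
      qed
      then have "outer.potential (x K) (xb K) \<le> (1 - outer.\<tau>) ^ K * outer.potential x0 x0"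
        using outer.prox_run_potential[of 0 K x xb] run by (simp add: outer_run_def)
      also have "\<dots> \<le> (1 - outer.\<tau>) ^ K * (2 * C0)"
        using outer.\<tau> pos by (intro mult_left_mono) (auto simp: outer.potential_def C0)
      finally have "\<mu> * (norm (x K - argmin h))\<^sup>2 \<le> \<epsilon>"
        using K(1) outer.potential_ge(1)[of "x K" "xb K"] by linarith
      moreover have "real (rounds_f K) \<le> abs_const * (sqrt (\<delta>f / \<mu>) * L)"
      proof -
        have "real (rounds_f K) \<le> 44 * (sqrt (\<delta>f / \<mu>) * L)"
          using K_le by (simp add: rounds_f_def mult_ac)
        also have "\<dots> \<le> abs_const * (sqrt (\<delta>f / \<mu>) * L)"
          using L_ge pos by (intro mult_right_mono) (auto simp: abs_const_def)
        finally show ?thesis .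
      qed
      moreover have "real (rounds_g K T) \<le> abs_const * (sqrt (\<delta>g / \<mu>) * L * (1 + \<Lambda>))"
      proof -
        have "real (rounds_g K T) = (\<Sum>k<K. 2 * real (T k) + 1)"
          by (simp add: rounds_g_def add.commute mult.commute)
        also have "\<dots> \<le> (\<Sum>k<K. 348 * (1 + \<Lambda>) * sqrt (\<delta>g / \<delta>f))"
        proof (rule sum_mono)
          fix k assume "k \<in> {..<K}"
          then have "1 \<le> real (T k)" "real (T k) \<le> 116 * (1 + \<Lambda>) * sqrt (\<delta>g / \<delta>f)"
            using T(1,3)[of k] by auto
          then show "2 * real (T k) + 1 \<le> 348 * (1 + \<Lambda>) * sqrt (\<delta>g / \<delta>f)" by linarith
        qed
        also have "\<dots> = real K * (348 * (1 + \<Lambda>) * sqrt (\<delta>g / \<delta>f))" by simp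
        also have "\<dots> \<le> 22 * L * sqrt (\<delta>f / \<mu>) * (348 * (1 + \<Lambda>) * sqrt (\<delta>g / \<delta>f))"
          using K_le \<Lambda> pos by (intro mult_right_mono) auto
        also have "\<dots> = 7656 * ((sqrt (\<delta>f / \<mu>) * sqrt (\<delta>g / \<delta>f)) * L * (1 + \<Lambda>))"
          by (simp add: mult_ac)
        also have "sqrt (\<delta>f / \<mu>) * sqrt (\<delta>g / \<delta>f) = sqrt (\<delta>g / \<mu>)"
          using pos by (simp flip: real_sqrt_mult)
        also have "7656 * (sqrt (\<delta>g / \<mu>) * L * (1 + \<Lambda>)) \<le> abs_const * (sqrt (\<delta>g / \<mu>) * L * (1 + \<Lambda>))"
          using L_ge \<Lambda> pos by (intro mult_right_mono) (auto simp: abs_const_def)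
        finally show ?thesis .
      qed
      ultimately show "(\<forall>k<K. inner_terminates \<delta>f P f f1 g (?y k) (zb k)) \<and>
          \<mu> * (norm (x K - argmin h))\<^sup>2 \<le> \<epsilon> \<and>
          real (rounds_f K) \<le> abs_const * (sqrt (\<delta>f / \<mu>) * L) \<and>
          real (rounds_g K T) \<le> abs_const * (sqrt (\<delta>g / \<mu>) * L * (1 + ln (\<delta>g / \<delta>f)))"
        using T(4) by (simp add: \<Lambda>_def)
    qed
  qed

  show ?thesis
  proof (rule exI[of _ P], rule exI[of _ Q], intro conjI allI impI)
    show "admissible P" unfolding P_def by (rule outer.admissible_tuned)
    show "admissible Q" unfolding Q_def by (rule composite.admissible_tuned[OF inner])
    show "\<exists>!u. is_arg_min (A_fun f (fs 1) g (theta P) y) (\<lambda>_. True) u" for y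
      using outer.model_ex1_min[of y] by (simp add: A_fun_def P_def f1_def)
    show "\<exists>!u. is_arg_min (B_fun f (fs 1) g (gs 1) (theta P) y (theta Q) w) (\<lambda>_. True) u" for y w
      using composite.model_ex1_min[OF inner, of y w]
      by (simp add: B_fun_def qf_def P_def Q_def f1_def g1_def)
  qed (use complexity in \<open>simp add: Let_def f1_def g1_def\<close>)
qed

end
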